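(* Let $\mathbb{F}_q$ be the finite field of $q$ elements and let $a_1,a_2,\ldots,a_k,b\in\mathbb{F}_q$. If $\sum_{i=1}^k a_i\neq 0$, then $$N_{\mathbb{F}_q}(a_1,a_2,\ldots,a_k;b)=\frac{1}{q}(q)_k.$$ If $\sum_{i=1}^k a_i=0$, then $$N_{\mathbb{F}_q}(a_1,a_2,\ldots,a_k;b)=\frac{1}{q}(q)_k-\frac{v(b)}{q}\left( d(a_1,a_2,\ldots,a_k)+\sum_{i=1}^k d(a_1,a_2,\ldots,a_{i-1},\widehat{a_i},a_{i+1},\ldots,a_k)\right),$$ where $v(b)=-1$ if $b\neq 0$, and $v(b)=q-1$ if $b=0$; the hat denotes the omission of an element, and $d(a_1,a_2,\ldots,a_k)$ satisfies $$d(a_1,a_2,\ldots,a_k)=\begin{cases}-v(a_1), & \text{if } k=1;\\ -\sum_{i=1}^k d(a_1,a_2,\ldots,a_{i-1},\widehat{a_i},a_{i+1},\ldots,a_k), & \text{if } k\geq 2 \text{ and } \sum_{i=1}^k a_i\neq 0;\\ (q-k)\,d(a_1,a_2,\ldots,a_{i-1},\widehat{a_i},a_{i+1},\ldots,a_k), & \text{if } k\geq 2 \text{ and } \sum_{i=1}^k a_i=0.\end{cases}$$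
   Context: For $a_1,\ldots,a_k,b\in\mathbb{F}_q$, $N_{\mathbb{F}_q}(a_1,\ldots,a_k;b)$ denotes the number of ordered tuples $(x_1,\ldots,x_k)\in\mathbb{F}_q^k$ with $x_i\neq x_j$ for all $i\neq j$ and $a_1x_1+a_2x_2+\cdots+a_kx_k=b$. $(q)_k=q(q-1)\cdots(q-k+1)$ denotes the falling factorial. *)

theory Defs
  imports Complex_Main "HOL-Library.Cardinality"
begin

text \<open>
  The field with \<open>q\<close> elements is an arbitrary type of class \<open>{field, finite}\<close>, with
  \<open>q = CARD('a)\<close>. Coefficient tuples \<open>a\<^sub>1, \<dots>, a\<^sub>k\<close> are lists of length \<open>k\<close>, so indices
  run over \<open>{..<k}\<close>.
\<close>

definition num_distinct_sols :: "'a::{field,finite} list \<Rightarrow> 'a \<Rightarrow> nat" where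
  "num_distinct_sols a b =
     card {x :: 'a list. length x = length a \<and> (\<forall>i<length a. \<forall>j<length a. i \<noteq> j \<longrightarrow> x ! i \<noteq> x ! j)
             \<and> (\<Sum>i<length a. a ! i * x ! i) = b}"

text \<open>The factors are real numbers, so there is no truncated subtraction.\<close>

definition falling_factorial :: "nat \<Rightarrow> nat \<Rightarrow> real" where
  "falling_factorial q k = (\<Prod>i<k. real q - real i)"

definition omit :: "nat \<Rightarrow> 'a list \<Rightarrow> 'a list" where
  "omit i a = take i a @ drop (Suc i) a"

definition v :: "'a::{field,finite} \<Rightarrow> int" where
  "v b = (if b = 0 then int CARD('a) - 1 else -1)"

text \<open>
  For a list of length at least 2 with sum \<open>0\<close> the recursion may omit any entry; the definition
  omits the first one, and independence of this choice is a theorem. The value at the empty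
  list is needed only for the formula for \<open>k = 1\<close>, where omitting the single coefficient leaves the
  empty tuple. The value \<open>-1\<close> is the one for which the equations for \<open>k \<ge> 2\<close>, read at
  \<open>k = 1\<close>, give \<open>d [a\<^sub>1] = - v a\<^sub>1\<close>; it does not influence \<open>d\<close> on nonempty lists.
\<close>

function d :: "'a::{field,finite} list \<Rightarrow> int" where
  "d a =
     (if length a = 0 then -1
      else if length a = 1 then - v (a ! 0)
      else if sum_list a \<noteq> 0 then - (\<Sum>i<length a. d (omit i a))
      else (int CARD('a) - int (length a)) * d (omit 0 a))"
  by pat_completeness auto
termination
  by (relation "measure length") (auto simp: omit_def)

declare d.simps [simp del]

end

theory Submission
  imports Defs
begin

text \<open>
  Let \<open>E(a) = N(a;0) - N(a;1)\<close>, and let \<open>F(a)\<close> be the same difference counting only solutions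
  with nonzero entries. Scaling solutions shows that \<open>N(a;b)\<close> is the same for all \<open>b \<noteq> 0\<close>, so
  \<open>q N(a;b) = (q)\<^sub>k + v(b) E(a)\<close>. At most one entry of a solution is zero, hence
  \<open>E(a) = F(a) + \<Sum>\<^sub>i F(a with a\<^sub>i omitted)\<close>. Translating solutions gives \<open>E(a) = 0\<close> if the sum of the
  coefficients is nonzero; if it is zero, translating \<open>x\<^sub>i\<close> to \<open>0\<close> gives
  \<open>E(a) = q F(a with a\<^sub>i omitted)\<close> for each \<open>i\<close>. Therefore \<open>- F\<close> satisfies the recursion that defines \<open>d\<close>.
\<close>

section \<open>Tuples with distinct entries and linear forms on them\<close>

definition distinct_lists :: "'a set \<Rightarrow> nat \<Rightarrow> 'a list set" where
  "distinct_lists A k = {x. length x = k \<and> distinct x \<and> set x \<subseteq> A}"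

definition dot :: "'a::comm_ring_1 list \<Rightarrow> 'a list \<Rightarrow> 'a" where
  "dot a x = sum_list (map2 (*) a x)"

text \<open>Taking \<open>A\<close> to be \<open>UNIV\<close> gives E and taking it to be
  \<open>- {0}\<close> gives F. Writing the difference as one sum over tuples lets both counts be
  reindexed and split together.\<close>

definition count_diff :: "'a::{field,finite} set \<Rightarrow> 'a list \<Rightarrow> int" where
  "count_diff A a =
     (\<Sum>x\<in>distinct_lists A (length a). of_bool (dot a x = 0) - of_bool (dot a x = 1))"

lemma length_omit: "i < length a \<Longrightarrow> length (omit i a) = length a - 1"
  by (auto simp: omit_def)

lemma finite_distinct_lists [simp]:
  "finite (distinct_lists (A :: 'a::finite set) k)"
  by (rule finite_subset[OF _ finite_lists_length_eq[of UNIV k]]) (auto simp: distinct_lists_def)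

lemma card_distinct_lists:
  "real (card (distinct_lists (UNIV :: 'a::finite set) k)) = falling_factorial CARD('a) k"
proof (cases "k \<le> CARD('a)")
  case True
  have "card (distinct_lists (UNIV :: 'a set) k) = \<Prod>{CARD('a) - k + 1..CARD('a)}"
    unfolding distinct_lists_def by (rule card_lists_distinct_length_eq) (use True in auto)
  also have "\<dots> = (\<Prod>i<k. CARD('a) - i)"
    by (rule prod.reindex_bij_witness[of _ "\<lambda>i. CARD('a) - i" "\<lambda>i. CARD('a) - i"])
      (use True in auto)
  finally show ?thesis
    using True by (auto simp: falling_factorial_def of_nat_diff intro!: prod.cong)
next
  case False
  have "length x \<le> CARD('a)" if "distinct x" for x :: "'a list"
    using that by (metis card_mono distinct_card finite_class.finite_UNIV subset_UNIV)
  with False have "distinct_lists (UNIV :: 'a set) k = {}"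
    by (auto simp: distinct_lists_def)
  \<comment> \<open>For k > q the product contains the factor with i = q, which is zero.\<close>
  moreover have "falling_factorial CARD('a) k = 0"
    using False by (auto simp: falling_factorial_def)
  ultimately show ?thesis by simp
qed

lemma dot_conv_nth:
  "length x = length a \<Longrightarrow> dot a x = (\<Sum>i<length a. a ! i * x ! i)"
  by (auto simp: dot_def sum_list_sum_nth atLeast0LessThan intro!: sum.cong)

lemma dot_map_add: "length x = length a \<Longrightarrow> dot a (map ((+) c) x) = dot a x + c * sum_list a"
  by (induction x a rule: list_induct2) (auto simp: dot_def algebra_simps)

lemma dot_map_mult: "length x = length a \<Longrightarrow> dot a (map ((*) c) x) = c * dot a x"
  by (induction x a rule: list_induct2) (auto simp: dot_def algebra_simps)

lemma dot_omit:
  assumes "length x = length a" "i < length a"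
  shows "dot a x = a ! i * x ! i + dot (omit i a) (omit i x)"
proof -
  have "dot a x = dot (take i a @ a ! i # drop (Suc i) a) (take i x @ x ! i # drop (Suc i) x)"
    using assms by (metis id_take_nth_drop)
  also have "\<dots> = a ! i * x ! i + dot (omit i a) (omit i x)"
    using assms by (simp add: dot_def omit_def algebra_simps)
  finally show ?thesis .
qed

lemma num_distinct_sols_eq:
  "num_distinct_sols a b = card {x \<in> distinct_lists UNIV (length a). dot a x = b}"
  unfolding num_distinct_sols_def distinct_lists_def
  by (rule arg_cong[of _ _ card]) (auto simp: distinct_conv_nth dot_conv_nth)

lemma count_diff_UNIV:
  "count_diff UNIV a = int (num_distinct_sols a 0) - int (num_distinct_sols a 1)"
  by (simp add: count_diff_def num_distinct_sols_eq sum_subtractf of_bool_def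
      flip: sum.inter_filter)

section \<open>Symmetries of the solution counts\<close>

lemma sum_distinct_lists_map:
  fixes f :: "'a::finite \<Rightarrow> 'a"
  assumes "inj f"
  shows "(\<Sum>x\<in>distinct_lists UNIV k. g (map f x)) = (\<Sum>x\<in>distinct_lists UNIV k. g x)"
proof (rule sum.reindex_bij_witness[of _ "map (inv f)" "map f"])
  \<comment> \<open>On a finite type \<open>f\<close> is also surjective, so \<open>inv f\<close> is
    a two-sided inverse and applying \<open>f\<close> entrywise permutes the tuples.\<close>
  have "inj (inv f)" "surj f"
    using assms by (auto simp: finite_UNIV_inj_surj intro!: surj_imp_inj_inv)
  then show "map f (map (inv f) x) = x" "map (inv f) x \<in> distinct_lists UNIV k"
    if "x \<in> distinct_lists UNIV k" for x
    using that by (auto simp: distinct_lists_def distinct_map o_def surj_f_inv_f inj_on_def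
        intro!: map_idI)
qed (use assms in \<open>auto simp: distinct_lists_def distinct_map inj_on_def\<close>)

lemma num_distinct_sols_translate:
  "num_distinct_sols a (b + c * sum_list a) = num_distinct_sols a b"
proof -
  have "num_distinct_sols a (b + c * sum_list a) =
      (\<Sum>x\<in>distinct_lists UNIV (length a). of_bool (dot a (map ((+) c) x) = b + c * sum_list a))"
    by (subst sum_distinct_lists_map)
      (auto simp: num_distinct_sols_eq of_bool_def simp flip: sum.inter_filter)
  also have "\<dots> = (\<Sum>x\<in>distinct_lists UNIV (length a). of_bool (dot a x = b))"
    by (intro sum.cong) (auto simp: distinct_lists_def dot_map_add)
  also have "\<dots> = num_distinct_sols a b"
    by (auto simp: num_distinct_sols_eq of_bool_def simp flip: sum.inter_filter)
  finally show ?thesis .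
qed

text \<open>Multiplying all entries by a nonzero c permutes the tuples and multiplies the linear
  form by c. With b = 1 this makes the count the same for all nonzero right-hand sides.\<close>

lemma num_distinct_sols_scale:
  assumes "c \<noteq> 0"
  shows "num_distinct_sols a (c * b) = num_distinct_sols a b"
proof -
  have "num_distinct_sols a (c * b) =
      (\<Sum>x\<in>distinct_lists UNIV (length a). of_bool (dot a (map ((*) c) x) = c * b))"
    using assms by (subst sum_distinct_lists_map)
      (auto simp: num_distinct_sols_eq of_bool_def inj_on_def simp flip: sum.inter_filter)
  also have "\<dots> = (\<Sum>x\<in>distinct_lists UNIV (length a). of_bool (dot a x = b))"
    using assms by (intro sum.cong) (auto simp: distinct_lists_def dot_map_mult)
  also have "\<dots> = num_distinct_sols a b"
    by (auto simp: num_distinct_sols_eq of_bool_def simp flip: sum.inter_filter)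
  finally show ?thesis .
qed

text \<open>Translating by the inverse of the coefficient sum moves the right-hand side from 0 to
  1.\<close>

lemma count_diff_UNIV_eq_0:
  assumes "sum_list a \<noteq> 0"
  shows "count_diff UNIV a = 0"
  using num_distinct_sols_translate[of a 0 "1 / sum_list a"] assms by (simp add: count_diff_UNIV)

section \<open>Recovering the counts from their difference\<close>

lemma sum_num_distinct_sols:
  fixes a :: "'a::{field,finite} list"
  shows "(\<Sum>b\<in>UNIV. num_distinct_sols a b) = card (distinct_lists (UNIV :: 'a set) (length a))"
  using sum_fun_comp[of "distinct_lists (UNIV :: 'a set) (length a)" UNIV "dot a" "\<lambda>_. 1 :: nat"]
  by (simp add: num_distinct_sols_eq)

text \<open>Two linear equations determine the counts: N(a;0) + (q - 1) N(a;1) is the number of all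
  tuples, and N(a;0) - N(a;1) = E(a). The two values of \<open>v\<close> are the coefficients of
  E(a) in the solution.\<close>

lemma num_distinct_sols_eq_count_diff:
  fixes a :: "'a::{field,finite} list"
  shows "real (num_distinct_sols a b) =
    1 / real CARD('a) * falling_factorial CARD('a) (length a)
      + real_of_int (v b) / real CARD('a) * real_of_int (count_diff UNIV a)"
proof -
  have const: "num_distinct_sols a c = num_distinct_sols a 1" if "c \<noteq> 0" for c
    using num_distinct_sols_scale[OF that, of a 1] by simp
  have "(\<Sum>c\<in>UNIV. num_distinct_sols a c) =
      num_distinct_sols a 0 + (\<Sum>c\<in>UNIV - {0}. num_distinct_sols a c)"
    by (simp add: sum.remove)
  also have "(\<Sum>c\<in>UNIV - {0}. num_distinct_sols a c) = (CARD('a) - 1) * num_distinct_sols a 1"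
    by (subst sum.cong[OF refl const]) auto
  finally have "falling_factorial CARD('a) (length a) =
      real (num_distinct_sols a 0) + (real CARD('a) - 1) * real (num_distinct_sols a 1)"
    unfolding sum_num_distinct_sols card_distinct_lists[symmetric] by (simp add: of_nat_diff)
  then show ?thesis
    by (cases "b = 0") (auto simp: v_def count_diff_UNIV const[of b] field_simps)
qed

section \<open>Inserting and omitting one entry\<close>

lemma nth_insert: "i \<le> length y \<Longrightarrow> (take i y @ c # drop i y) ! i = c"
  by (simp add: nth_append)

lemma omit_insert: "i \<le> length y \<Longrightarrow> omit i (take i y @ c # drop i y) = y"
  by (simp add: omit_def)

lemma insert_omit:
  assumes "i < length x"
  shows "take i (omit i x) @ x ! i # drop i (omit i x) = x"
proof -
  have "take i (omit i x) = take i x" "drop i (omit i x) = drop (Suc i) x"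
    using assms by (auto simp: omit_def min_def)
  then show ?thesis
    using id_take_nth_drop[OF assms] by simp
qed

text \<open>With \<open>omit_in_distinct_lists\<close> this yields a bijection between tuples with
  entry c at position i and shorter tuples avoiding c.\<close>

lemma insert_in_distinct_lists:
  assumes "y \<in> distinct_lists (- {c}) (k - 1)" "i < k"
  shows "take i y @ c # drop i y \<in> distinct_lists UNIV k"
proof -
  have "length y = k - 1" "distinct (take i y @ drop i y)" "c \<notin> set (take i y @ drop i y)"
    using assms(1) unfolding append_take_drop_id by (auto simp: distinct_lists_def)
  then show ?thesis
    using assms(2) unfolding distinct_append set_append by (auto simp: distinct_lists_def)
qed

lemma omit_in_distinct_lists:
  assumes "x \<in> distinct_lists UNIV k" "i < k"
  shows "omit i x \<in> distinct_lists (- {x ! i}) (k - 1)"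
proof -
  have "distinct (take i x @ x ! i # drop (Suc i) x)"
    using assms by (subst id_take_nth_drop[symmetric]) (auto simp: distinct_lists_def)
  then show ?thesis
    using assms by (auto simp: distinct_lists_def omit_def)
qed

text \<open>Deleting a zero entry does not change the linear form, and distinctness makes all
  remaining entries nonzero.\<close>

lemma sum_distinct_lists_zero_at:
  fixes a :: "'a::{field,finite} list"
  assumes "i < length a"
  shows "(\<Sum>x | x \<in> distinct_lists UNIV (length a) \<and> x ! i = 0.
            of_bool (dot a x = 0) - of_bool (dot a x = 1)) = count_diff (- {0}) (omit i a)"
  unfolding count_diff_def length_omit[OF assms]
proof (rule sum.reindex_bij_witness[of _ "\<lambda>y. take i y @ 0 # drop i y" "omit i"], goal_cases)
  case (1 x)
  then show ?case
    using insert_omit[of i x] assms by (auto simp: distinct_lists_def)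
next
  case (2 x)
  then show ?case
    using omit_in_distinct_lists[of x "length a" i] assms by auto
next
  case (3 y)
  then show ?case
    using assms by (intro omit_insert) (auto simp: distinct_lists_def)
next
  case (4 y)
  then have "i \<le> length y"
    using assms by (auto simp: distinct_lists_def)
  with 4 show ?case
    using insert_in_distinct_lists[of y 0 "length a" i] assms by (simp add: nth_insert)
next
  case (5 x)
  then show ?case
    using dot_omit[of x a i] assms by (auto simp: distinct_lists_def)
qed

section \<open>Recursion for the difference over nonzero entries\<close>

lemma count_diff_UNIV_split:
  fixes a :: "'a::{field,finite} list"
  shows "count_diff UNIV a =
    count_diff (- {0}) a + (\<Sum>i<length a. count_diff (- {0}) (omit i a))"
proof -
  let ?k = "length a"
  let ?Z = "\<lambda>i. {x \<in> distinct_lists (UNIV :: 'a set) ?k. x ! i = 0}"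
  let ?w = "\<lambda>x. of_bool (dot a x = 0) - of_bool (dot a x = 1) :: int"
  have eq: "distinct_lists UNIV ?k = distinct_lists (- {0}) ?k \<union> (\<Union>i<?k. ?Z i)"
    by (auto simp: distinct_lists_def in_set_conv_nth)
  have "distinct_lists (- {0}) ?k \<inter> (\<Union>i<?k. ?Z i) = {}"
    by (auto simp: distinct_lists_def) (metis nth_mem)
  then have "count_diff UNIV a = count_diff (- {0}) a + sum ?w (\<Union>i<?k. ?Z i)"
    unfolding count_diff_def by (subst eq, subst sum.union_disjoint) auto
  also have "sum ?w (\<Union>i<?k. ?Z i) = (\<Sum>i<?k. sum ?w (?Z i))"
  proof (rule sum.UNION_disjoint)
    \<comment> \<open>A tuple with distinct entries cannot be zero at two positions.\<close>
    show "\<forall>i\<in>{..<?k}. \<forall>j\<in>{..<?k}. i \<noteq> j \<longrightarrow> ?Z i \<inter> ?Z j = {}"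
      by (auto simp: distinct_lists_def) (metis nth_eq_iff_index_eq)
  qed auto
  finally show ?thesis
    by (simp add: sum_distinct_lists_zero_at)
qed

lemma count_diff_UNIV_eq_omit:
  fixes a :: "'a::{field,finite} list"
  assumes "sum_list a = 0" "i < length a"
  shows "count_diff UNIV a = int CARD('a) * count_diff (- {0}) (omit i a)"
proof -
  let ?X = "distinct_lists (UNIV :: 'a set) (length a)"
  let ?w = "\<lambda>x. of_bool (dot a x = 0) - of_bool (dot a x = 1) :: int"
  have "sum ?w {x \<in> ?X. x ! i = c} = count_diff (- {0}) (omit i a)" for c
  proof -
    \<comment> \<open>Translation by c leaves the linear form unchanged because the coefficients sum
      to zero.\<close>
    have "sum ?w {x \<in> ?X. x ! i = c} = sum ?w {x \<in> ?X. x ! i = 0}"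
      by (rule sum.reindex_bij_witness[of _ "map ((+) c)" "map ((+) (- c))"])
        (use assms in \<open>auto simp: distinct_lists_def distinct_map o_def dot_map_add\<close>)
    then show ?thesis
      using assms by (simp add: sum_distinct_lists_zero_at)
  qed
  then have "(\<Sum>c\<in>UNIV. sum ?w {x \<in> ?X. x ! i = c}) =
      int CARD('a) * count_diff (- {0}) (omit i a)"
    by simp
  moreover have "(\<Sum>c\<in>UNIV. sum ?w {x \<in> ?X. x ! i = c}) = sum ?w ?X"
    by (rule sum.group) auto
  ultimately show ?thesis
    by (simp add: count_diff_def)
qed

text \<open>Since E(a) = q F(a with one entry omitted) for every position, these values of F all
  agree. The splitting of E(a) then reads q F' = F(a) + k F' for their common value F'.\<close>

lemma count_diff_nonzero_rec:
  fixes a :: "'a::{field,finite} list"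
  assumes "sum_list a = 0" "i < length a"
  shows "count_diff (- {0}) a = (int CARD('a) - int (length a)) * count_diff (- {0}) (omit i a)"
proof -
  have "count_diff (- {0}) (omit j a) = count_diff (- {0}) (omit i a)" if "j < length a" for j
    using count_diff_UNIV_eq_omit[OF assms] count_diff_UNIV_eq_omit[OF assms(1) that] by simp
  then show ?thesis
    using count_diff_UNIV_split[of a] count_diff_UNIV_eq_omit[OF assms]
    by (simp add: algebra_simps)
qed

section \<open>Identification of \<open>d\<close>\<close>

lemma count_diff_Nil: "count_diff A [] = 1"
proof -
  have "distinct_lists A 0 = {[]}" for A :: "'a set"
    by (auto simp: distinct_lists_def)
  then show ?thesis by (simp add: count_diff_def dot_def)
qed

text \<open>Both cases come from the recursion with value 1 at the empty list: the factor is q - 1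
  if c = 0, and F + 1 = E = 0 otherwise.\<close>

lemma count_diff_nonzero_singleton: "count_diff (- {0}) [c] = v c"
  for c :: "'a::{field,finite}"
proof (cases "c = 0")
  case True
  then show ?thesis
    using count_diff_nonzero_rec[of "[c]" 0] by (simp add: omit_def count_diff_Nil v_def)
next
  case False
  then show ?thesis
    using count_diff_UNIV_split[of "[c]"] count_diff_UNIV_eq_0[of "[c]"]
    by (simp add: omit_def count_diff_Nil v_def)
qed

text \<open>Both sides satisfy the same recursion, and the value -1 of \<open>d\<close> at the empty
  list matches \<open>count_diff_Nil\<close>.\<close>

lemma d_eq_count_diff: "d a = - count_diff (- {0}) a"
proof (induction "length a" arbitrary: a rule: less_induct)
  case less
  have IH: "d (omit i a) = - count_diff (- {0}) (omit i a)" if "i < length a" for i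
    using that less by (simp add: length_omit)
  consider "a = []" | c where "a = [c]" | "length a \<ge> 2" "sum_list a \<noteq> 0"
    | "length a \<ge> 2" "sum_list a = 0"
    by (cases a; cases "tl a") auto
  then show ?case
  proof cases
    case 1
    then show ?thesis by (simp add: d.simps count_diff_Nil)
  next
    case 2
    then show ?thesis by (simp add: d.simps count_diff_nonzero_singleton)
  next
    case 3
    then have "d a = - (\<Sum>i<length a. d (omit i a))"
      by (subst d.simps) auto
    then show ?thesis
      using count_diff_UNIV_split[of a] count_diff_UNIV_eq_0[OF 3(2)] IH
      by (simp add: sum_negf)
  next
    case 4
    then have "0 < length a" by linarith
    have "d a = (int CARD('a) - int (length a)) * d (omit 0 a)"
      using 4 by (subst d.simps) auto
    then show ?thesis
      using IH[of 0] count_diff_nonzero_rec[OF 4(2), of 0] \<open>0 < length a\<close> by simp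
  qed
qed

theorem theorem1p3:
  fixes a :: "'a::{field,finite} list" and b :: 'a and k q :: nat
  assumes "q = CARD('a)" and "length a = k" and "k \<ge> 1"
  shows
    "(sum_list a \<noteq> 0 \<longrightarrow>
        real (num_distinct_sols a b) = 1 / real q * falling_factorial q k) \<and>
     (sum_list a = 0 \<longrightarrow>
        real (num_distinct_sols a b) =
          1 / real q * falling_factorial q k
          - real_of_int (v b) / real q * real_of_int (d a + (\<Sum>i<k. d (omit i a)))) \<and>
     (k = 1 \<longrightarrow> d a = - v (a ! 0)) \<and>
     (k \<ge> 2 \<and> sum_list a \<noteq> 0 \<longrightarrow> d a = - (\<Sum>i<k. d (omit i a))) \<and>
     (k \<ge> 2 \<and> sum_list a = 0 \<longrightarrow> (\<forall>i<k. d a = (int q - int k) * d (omit i a)))"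
proof (intro conjI impI allI)
  assume "sum_list a \<noteq> 0"
  then show "real (num_distinct_sols a b) = 1 / real q * falling_factorial q k"
    using num_distinct_sols_eq_count_diff[of a b] count_diff_UNIV_eq_0[of a] assms by simp
next
  \<comment> \<open>The bracket is -E(a), so its minus sign turns into the plus sign in
    \<open>num_distinct_sols_eq_count_diff\<close>.\<close>
  have eq: "d a + (\<Sum>i<k. d (omit i a)) = - count_diff UNIV a"
    using assms by (simp add: d_eq_count_diff sum_negf count_diff_UNIV_split)
  then show "real (num_distinct_sols a b) = 1 / real q * falling_factorial q k
      - real_of_int (v b) / real q * real_of_int (d a + (\<Sum>i<k. d (omit i a)))"
    unfolding eq using num_distinct_sols_eq_count_diff[of a b] assms by simp
next
  assume "k = 1"
  then show "d a = - v (a ! 0)"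
    using assms by (subst d.simps) auto
next
  assume "k \<ge> 2 \<and> sum_list a \<noteq> 0"
  then show "d a = - (\<Sum>i<k. d (omit i a))"
    using assms by (subst d.simps) auto
next
  fix i
  assume "k \<ge> 2 \<and> sum_list a = 0" "i < k"
  \<comment> \<open>The definition of \<open>d\<close> only omits the first entry; the recursion for
    F holds at every position and carries over to \<open>d\<close>.\<close>
  then show "d a = (int q - int k) * d (omit i a)"
    using assms count_diff_nonzero_rec[of a i] by (simp add: d_eq_count_diff)
qed

end
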